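(* Let $C\subset\mathbb{Z}_2^n$ be a $6$-cap. Then $\dim(C)\in\{4,5\}$. If $\dim(C)=5$, then $C$ is affinely independent. If $\dim(C)=4$, then: (a) $C$ is complete in dimension $4$, i.e. no point of the $4$-flat $\mathrm{aff}(C)$ outside $C$ can be added to $C$ to form a cap; (b) $C$ is a maximal cap in dimension $4$; (c) every point of $\mathrm{exc}(C)$ has multiplicity $2$.
   Context: $\mathbb{Z}_2^n$ is the $n$-dimensional vector space over $\mathbb{Z}_2$. A quad is a set of four distinct elements $a,b,c,d$ with $a+b+c+d=\vec 0$; a cap is a subset containing no quad; a $k$-cap is a cap with $k$ elements. For $S\subset\mathbb{Z}_2^n$, $\mathrm{exc}(S)=\{a+b+c: a,b,c\in S\text{ distinct}\}$; the multiplicity of $p\in\mathrm{exc}(S)$ is the number of $3$-element subsets $\{x,y,z\}\subset S$ with $x+y+z=p$. Over $\mathbb{Z}_2$, affine combinations are sums of an odd number of elements; $\mathrm{aff}(S)$ is the set of affine combinations of elements of $S$; $S$ is affinely independent if no element is an affine combination of the others. The dimension $\dim(C)$ of a cap is the dimension of the flat $\mathrm{aff}(C)$. A cap in dimension $r$ is maximal if it is complete in its $r$-flat and has the largest size among caps contained in an $r$-flat. *)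

theory Defs
  imports "HOL-Analysis.Analysis" "HOL-Library.Z2"
begin

instance bit :: finite
proof
  have "(UNIV :: bit set) \<subseteq> {0, 1}"
    by (auto intro: bit_not_one_iff [THEN iffD1])
  then show "finite (UNIV :: bit set)"
    by (rule finite_subset) simp
qed

text \<open>The space $\mathbb{Z}_2^n$ is the type \<open>bit ^ 'n\<close>, with \<open>n = CARD('n)\<close>.\<close>

definition quad :: "(bit ^ 'n) set \<Rightarrow> bool" where
  "quad Q \<longleftrightarrow> (\<exists>a b c d. distinct [a, b, c, d] \<and> Q = {a, b, c, d} \<and> a + b + c + d = 0)"

definition cap :: "(bit ^ 'n) set \<Rightarrow> bool" where
  "cap C \<longleftrightarrow> (\<forall>Q. Q \<subseteq> C \<longrightarrow> \<not> quad Q)"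

definition k_cap :: "nat \<Rightarrow> (bit ^ 'n) set \<Rightarrow> bool" where
  "k_cap k C \<longleftrightarrow> cap C \<and> finite C \<and> card C = k"

definition exc :: "(bit ^ 'n) set \<Rightarrow> (bit ^ 'n) set" where
  "exc S = {a + b + c | a b c. a \<in> S \<and> b \<in> S \<and> c \<in> S \<and> distinct [a, b, c]}"

definition multiplicity_exc :: "(bit ^ 'n) set \<Rightarrow> bit ^ 'n \<Rightarrow> nat" where
  "multiplicity_exc S p = card {T. T \<subseteq> S \<and> card T = 3 \<and> \<Sum>T = p}"

text \<open>Over $\mathbb{Z}_2$ the coefficients of an affine combination are 0 or 1 and sum to 1, so
  the affine combinations of elements of \<open>S\<close> are the sums over subsets of \<open>S\<close> of odd size.\<close>

definition aff :: "(bit ^ 'n) set \<Rightarrow> (bit ^ 'n) set" where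
  "aff S = {\<Sum>T | T. T \<subseteq> S \<and> finite T \<and> odd (card T)}"

definition affinely_independent :: "(bit ^ 'n) set \<Rightarrow> bool" where
  "affinely_independent S \<longleftrightarrow> (\<forall>x\<in>S. x \<notin> aff (S - {x}))"

definition r_flat :: "nat \<Rightarrow> (bit ^ 'n) set \<Rightarrow> bool" where
  "r_flat r F \<longleftrightarrow> (\<exists>a V. vec.subspace V \<and> vec.dim V = r \<and> F = (\<lambda>v. a + v) ` V)"

text \<open>If \<open>F = a + V\<close> with \<open>V\<close> a subspace, then the set of differences of points of \<open>F\<close> is \<open>V\<close>.\<close>

definition flat_dim :: "(bit ^ 'n) set \<Rightarrow> nat" where
  "flat_dim F = vec.dim {x - y | x y. x \<in> F \<and> y \<in> F}"

definition cap_dim :: "(bit ^ 'n) set \<Rightarrow> nat" where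
  "cap_dim C = flat_dim (aff C)"

definition complete_cap_in :: "(bit ^ 'n) set \<Rightarrow> (bit ^ 'n) set \<Rightarrow> bool" where
  "complete_cap_in F C \<longleftrightarrow> cap C \<and> C \<subseteq> F \<and> (\<forall>p \<in> F - C. \<not> cap (insert p C))"

text \<open>The size of \<open>C\<close> is compared with caps in all \<open>r\<close>-flats of the space, not only in \<open>aff C\<close>.\<close>

definition maximal_cap :: "nat \<Rightarrow> (bit ^ 'n) set \<Rightarrow> bool" where
  "maximal_cap r C \<longleftrightarrow> cap C \<and> cap_dim C = r \<and> complete_cap_in (aff C) C \<and>
     (\<forall>(F :: (bit ^ 'n) set) D. r_flat r F \<and> D \<subseteq> F \<and> cap D \<longrightarrow> card D \<le> card C)"

end

theory Submission
  imports Defs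
begin

text \<open>Sums of subsets turn symmetric differences into sums, so everything is governed by the
  subsets of even size with sum zero. In a 6-cap such a subset cannot have 2 or 4 elements, so the
  only candidate besides the empty set is the whole cap: the cap is affinely independent of
  dimension 5 if its sum is nonzero, and of dimension 4 if its sum is zero. A 7-cap in a 4-flat
  would have all its 6-element subsets of sum zero, making its elements equal. Two triples of a
  6-cap have equal sums only if they are equal or complementary.\<close>

section \<open>Arithmetic in characteristic two and sums over symmetric differences\<close>

lemma bit_vec_add_self [simp]: "(x :: bit ^ 'n) + x = 0"
  by (simp add: vec_eq_iff)

lemma bit_vec_add_self_left [simp]: "(x :: bit ^ 'n) + (x + y) = y"
  by (simp flip: add.assoc)

lemma bit_vec_diff [simp]: "(x :: bit ^ 'n) - y = x + y"
  by (simp add: vec_eq_iff)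

lemma bit_vec_add_eq_0_iff: "(x :: bit ^ 'n) + y = 0 \<longleftrightarrow> x = y"
  by (metis add.right_neutral bit_vec_add_self bit_vec_add_self_left)

text \<open>Common elements are counted twice on the right and cancel. Comparing two subsets with
  equal sums thus reduces to one subset with sum zero.\<close>

lemma sum_sym_diff:
  fixes A B :: "(bit ^ 'n) set"
  shows "\<Sum>(sym_diff A B) = \<Sum>A + \<Sum>B"
proof -
  have "\<Sum>(sym_diff A B) = \<Sum>(A - B) + \<Sum>(B - A)"
    by (rule sum.union_disjoint) auto
  moreover have "\<Sum>A = \<Sum>(A - B) + \<Sum>(A \<inter> B)" "\<Sum>B = \<Sum>(B - A) + \<Sum>(A \<inter> B)"
    by (subst sum.union_disjoint [symmetric]; auto intro: arg_cong [where f = "\<lambda>A. \<Sum>A"])+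
  ultimately show ?thesis
    by (simp add: ac_simps)
qed

lemma even_card_sym_diff:
  assumes "finite A" "finite B"
  shows "even (card (sym_diff A B)) \<longleftrightarrow> (even (card A) \<longleftrightarrow> even (card B))"
proof -
  have "card (sym_diff A B) = card (A - B) + card (B - A)"
    using assms by (intro card_Un_disjoint) auto
  moreover have "card A = card (A - B) + card (A \<inter> B)" "card B = card (B - A) + card (A \<inter> B)"
    using assms by (subst card_Un_disjoint [symmetric]; auto intro: arg_cong [where f = card])+
  ultimately show ?thesis
    by auto
qed

lemma sum_translate:
  fixes a :: "bit ^ 'n"
  shows "(\<Sum>x\<in>T. a + x) = (if odd (card T) then a else 0) + \<Sum>T"
proof -
  have "finite T"
    by simp
  then show ?thesis
    by (induction T rule: finite_induct) (auto simp: ac_simps)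
qed

section \<open>Affine hulls as translates of linear spans\<close>

lemma span_bit_eq_subset_sums:
  fixes B :: "(bit ^ 'n) set"
  shows "vec.span B = (\<lambda>T. \<Sum>T) ` Pow B"
proof (intro equalityI subsetI)
  fix v assume "v \<in> vec.span B"
  then obtain t r where t: "t \<subseteq> B" and v: "v = (\<Sum>x\<in>t. r x *s x)"
    by (auto simp: vec.span_explicit)
  \<comment> \<open>The only scalars are 0 and 1, so a linear combination is the sum over the
    support of its coefficients.\<close>
  have "v = (\<Sum>x\<in>{x \<in> t. r x = 1}. x)"
    unfolding v by (rule sum.mono_neutral_cong_right) auto
  then show "v \<in> (\<lambda>T. \<Sum>T) ` Pow B"
    using t by blast
next
  fix v assume "v \<in> (\<lambda>T. \<Sum>T) ` Pow B"
  then show "v \<in> vec.span B"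
    by (auto intro!: vec.span_sum intro: vec.span_base)
qed

text \<open>Moving the base point \<open>a\<close> to the origin turns affine questions into linear
  ones. An odd number of copies of \<open>a\<close> adds up to \<open>a\<close>, an even number to
  zero.\<close>

lemma aff_eq_translate_span:
  assumes "a \<in> S"
  shows "aff S = (+) a ` vec.span ((+) a ` S)"
proof (intro equalityI subsetI)
  fix v assume "v \<in> aff S"
  then obtain T where T: "T \<subseteq> S" "odd (card T)" "v = \<Sum>T"
    by (auto simp: aff_def)
  have "a + v = (\<Sum>x\<in>T. a + x)"
    using T by (simp add: sum_translate)
  also have "\<dots> \<in> vec.span ((+) a ` S)"
    using T(1) by (auto intro!: vec.span_sum intro: vec.span_base)
  finally show "v \<in> (+) a ` vec.span ((+) a ` S)"
    by (rule rev_image_eqI) simp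
next
  fix v assume "v \<in> (+) a ` vec.span ((+) a ` S)"
  then obtain T where T: "T \<subseteq> (+) a ` S" "v = a + \<Sum>T"
    by (auto simp: span_bit_eq_subset_sums)
  then obtain U where U: "U \<subseteq> S" "T = (+) a ` U"
    by (auto simp: subset_image_iff)
  have v: "v = a + (\<Sum>x\<in>U. a + x)"
    unfolding T U by (simp add: sum.reindex)
  show "v \<in> aff S"
  proof (cases "odd (card U)")
    case True
    then show ?thesis
      using U v by (auto simp: sum_translate aff_def)
  next
    case False
    \<comment> \<open>Toggling the membership of \<open>a\<close> in \<open>U\<close> adds
      \<open>a\<close> to the sum and makes the even size odd.\<close>
    then have "v = \<Sum>(sym_diff {a} U)"
      unfolding sum_sym_diff using v by (simp add: sum_translate)
    moreover have "odd (card (sym_diff {a} U))"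
      using False by (subst even_card_sym_diff) auto
    moreover have "sym_diff {a} U \<subseteq> S"
      using U assms by auto
    ultimately show ?thesis
      unfolding aff_def by (intro CollectI exI [of _ "sym_diff {a} U"] conjI) simp_all
  qed
qed

lemma subset_aff: "S \<subseteq> aff S"
proof
  fix x assume "x \<in> S"
  then show "x \<in> aff S"
    unfolding aff_def by (intro CollectI exI [of _ "{x}"]) auto
qed

lemma aff_insert_absorb:
  assumes "b \<in> aff S"
  shows "aff (insert b S) = aff S"
proof -
  obtain a where a: "a \<in> S"
    using assms by (force simp: aff_def)
  have "a + b \<in> vec.span ((+) a ` S)"
    using assms unfolding aff_eq_translate_span [OF a] by auto
  then have "vec.span ((+) a ` insert b S) = vec.span ((+) a ` S)"
    by (simp add: vec.span_redundant)
  then show ?thesis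
    using a by (simp add: aff_eq_translate_span [of a])
qed

section \<open>Dimension of flats and affine independence\<close>

lemma flat_dim_translate_subspace:
  assumes "vec.subspace V"
  shows "flat_dim ((+) a ` V) = vec.dim V"
proof -
  have "{x - y | x y. x \<in> (+) a ` V \<and> y \<in> (+) a ` V} = V" (is "?D = V")
  proof (intro equalityI subsetI)
    fix v assume "v \<in> ?D"
    then obtain x y where "x \<in> V" "y \<in> V" "v = (a + x) - (a + y)"
      by auto
    moreover have "(a + x) - (a + y) = x + y"
      by (simp add: ac_simps)
    ultimately show "v \<in> V"
      using assms by (simp add: vec.subspace_add)
  next
    fix v assume "v \<in> V"
    moreover have "v = (a + v) - (a + 0)"
      by (simp add: ac_simps)
    moreover have "0 \<in> V"
      using assms by (rule vec.subspace_0)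
    ultimately show "v \<in> ?D"
      by blast
  qed
  then show ?thesis
    by (simp add: flat_dim_def)
qed

lemma cap_dim_eq_dim_span:
  assumes "a \<in> S"
  shows "cap_dim S = vec.dim ((+) a ` S)"
  unfolding cap_dim_def aff_eq_translate_span [OF assms]
  by (simp add: flat_dim_translate_subspace)

lemma r_flat_aff:
  assumes "S \<noteq> {}"
  shows "r_flat (cap_dim S) (aff S)"
proof -
  obtain a where a: "a \<in> S"
    using assms by blast
  show ?thesis
    unfolding r_flat_def
  proof (intro exI conjI)
    show "vec.dim (vec.span ((+) a ` S)) = cap_dim S"
      using a by (simp add: cap_dim_eq_dim_span)
  qed (use a in \<open>auto simp: aff_eq_translate_span\<close>)
qed

text \<open>Translating by a point of \<open>S\<close> cancels the offset \<open>c\<close> of the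
  flat, so the translate of \<open>S\<close> lies in the direction space \<open>V\<close>.\<close>

lemma cap_dim_le_of_subset_flat:
  assumes "r_flat r F" "S \<subseteq> F" "S \<noteq> {}"
  shows "cap_dim S \<le> r"
proof -
  obtain c V where V: "vec.subspace V" "vec.dim V = r" "F = (+) c ` V"
    using assms(1) by (auto simp: r_flat_def)
  obtain a where a: "a \<in> S"
    using assms(3) by blast
  have "(+) a ` S \<subseteq> V"
  proof (rule image_subsetI)
    fix x assume "x \<in> S"
    then obtain u v where "u \<in> V" "v \<in> V" "a = c + u" "x = c + v"
      using a assms(2) V(3) by blast
    moreover have "(c + u) + (c + v) = u + v"
      by (simp add: ac_simps)
    ultimately show "a + x \<in> V"
      using V(1) by (simp add: vec.subspace_add)
  qed
  then show ?thesis
    using a V(2) by (simp add: cap_dim_eq_dim_span vec.dim_subset flip: V(2))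
qed

text \<open>Once a base point is moved to the origin, the other points become linearly independent
  vectors. For empty \<open>S\<close> both sides are 0, by truncated subtraction.\<close>

lemma cap_dim_affinely_independent:
  assumes "affinely_independent S"
  shows "cap_dim S = card S - 1"
proof (cases "S = {}")
  case True
  then show ?thesis
    by (simp add: cap_dim_def flat_dim_def aff_def)
next
  case False
  then obtain a where a: "a \<in> S"
    by blast
  have "vec.independent ((+) a ` (S - {a}))" (is "vec.independent ?B")
    unfolding vec.dependent_def
  proof
    assume "\<exists>y\<in>?B. y \<in> vec.span (?B - {y})"
    then obtain x where x: "x \<in> S" "x \<noteq> a" "a + x \<in> vec.span (?B - {a + x})"
      by blast
    \<comment> \<open>Since \<open>x\<close> differs from \<open>a\<close>, the base point survives
      in \<open>S - {x}\<close> and can serve for the hull of that set too.\<close>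
    have "?B - {a + x} \<subseteq> (+) a ` (S - {x})"
      by auto
    then have "a + x \<in> vec.span ((+) a ` (S - {x}))"
      using x(3) vec.span_mono by blast
    then have "x \<in> (+) a ` vec.span ((+) a ` (S - {x}))"
      by (rule rev_image_eqI) simp
    then have "x \<in> aff (S - {x})"
      using a x by (subst aff_eq_translate_span [of a]) auto
    then show False
      using assms x by (auto simp: affinely_independent_def)
  qed
  then have "vec.dim ?B = card S - 1"
    using a by (simp add: vec.dim_eq_card_independent card_image)
  moreover have "(+) a ` S = insert 0 ?B"
    using a by (metis bit_vec_add_self image_insert insert_Diff)
  then have "vec.dim ((+) a ` S) = vec.dim ?B"
    by (metis vec.dim_span vec.span_insert_0)
  ultimately show ?thesis
    using a by (simp add: cap_dim_eq_dim_span)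
qed

text \<open>If \<open>x\<close> is a sum of an odd number of other points, adjoining
  \<open>x\<close> to them gives a nonempty even subset with sum zero.\<close>

lemma affinely_independentI:
  assumes "\<And>T. T \<subseteq> S \<Longrightarrow> even (card T) \<Longrightarrow> \<Sum>T = 0 \<Longrightarrow> T = {}"
  shows "affinely_independent S"
  unfolding affinely_independent_def
proof (intro ballI notI)
  fix x assume x: "x \<in> S" "x \<in> aff (S - {x})"
  then obtain T where T: "T \<subseteq> S - {x}" "odd (card T)" "x = \<Sum>T"
    by (auto simp: aff_def)
  then have "x \<notin> T"
    by blast
  then have "even (card (insert x T))" "\<Sum>(insert x T) = x + \<Sum>T"
    using T(2) by auto
  then have "\<Sum>(insert x T) = 0"
    using T(3) by (metis bit_vec_add_self)
  then show False
    using assms [of "insert x T"] \<open>even (card (insert x T))\<close> x(1) T(1) by auto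
qed

section \<open>Caps and even subsets with sum zero\<close>

lemma cap_subset: "cap C \<Longrightarrow> D \<subseteq> C \<Longrightarrow> cap D"
  by (auto simp: cap_def)

lemma quad_iff: "quad Q \<longleftrightarrow> card Q = 4 \<and> \<Sum>Q = 0"
proof
  assume "quad Q"
  then show "card Q = 4 \<and> \<Sum>Q = 0"
    by (auto simp: quad_def ac_simps)
next
  assume Q: "card Q = 4 \<and> \<Sum>Q = 0"
  then obtain xs where xs: "set xs = Q" "distinct xs" "length xs = 4"
    by (metis finite finite_distinct_list distinct_card)
  then obtain a b c d where abcd: "xs = [a, b, c, d]"
    by (auto simp: numeral_eq_Suc length_Suc_conv)
  then have Q_eq: "Q = {a, b, c, d}"
    using xs(1) by simp
  then have "a + b + c + d = 0"
    using Q abcd xs(2) by (simp add: ac_simps)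
  then show "quad Q"
    unfolding quad_def using Q_eq abcd xs(2) by blast
qed

text \<open>Four elements with sum zero would be a quad, and two would coincide; below 6 only size 0
  remains.\<close>

lemma cap_even_zero_sum_subset:
  assumes "cap C" "T \<subseteq> C" "even (card T)" "\<Sum>T = 0" "card T < 6"
  shows "T = {}"
proof -
  have "card T \<noteq> 4"
    using assms by (auto simp: cap_def quad_iff)
  moreover have "card T \<noteq> 2"
  proof
    assume "card T = 2"
    then obtain x y where "T = {x, y}" "x \<noteq> y"
      by (auto simp: card_2_iff)
    then show False
      using assms(4) by (simp add: bit_vec_add_eq_0_iff)
  qed
  ultimately have "card T = 0"
    using assms(3,5) by presburger
  then show ?thesis
    by simp
qed

lemma six_cap_even_zero_sum_subset:
  assumes "k_cap 6 C" "T \<subseteq> C" "even (card T)" "\<Sum>T = 0"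
  shows "T = {} \<or> T = C"
proof -
  have "card T < 6" if "T \<noteq> C"
    using that assms psubset_card_mono [of C T] by (auto simp: k_cap_def)
  then show ?thesis
    using assms cap_even_zero_sum_subset by (auto simp: k_cap_def)
qed

section \<open>Dimension, size bound and multiplicities for 6-caps\<close>

lemma six_cap_affinely_independent:
  assumes "k_cap 6 C" "\<Sum>C \<noteq> 0"
  shows "affinely_independent C"
  using assms six_cap_even_zero_sum_subset by (intro affinely_independentI) blast

lemma six_cap_dim:
  assumes "k_cap 6 C"
  shows "cap_dim C = (if \<Sum>C = 0 then 4 else 5)"
proof (cases "\<Sum>C = 0")
  case False
  then show ?thesis
    using assms by (simp add: six_cap_affinely_independent cap_dim_affinely_independent k_cap_def)
next
  case True
  obtain b where b: "b \<in> C"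
    using assms by (force simp: k_cap_def)
  have card: "card (C - {b}) = 5"
    using b assms by (simp add: k_cap_def)
  \<comment> \<open>Without \<open>b\<close> the alternative \<open>T = C\<close> cannot occur.
    These five points span a flat of dimension 4, and \<open>b\<close>, being their sum, already
    lies in it.\<close>
  have "affinely_independent (C - {b})"
    using assms b six_cap_even_zero_sum_subset by (intro affinely_independentI) blast
  then have "cap_dim (C - {b}) = 4"
    using card by (simp add: cap_dim_affinely_independent)
  moreover have "\<Sum>C = b + \<Sum>(C - {b})"
    using b by (intro sum.remove) auto
  then have "b = \<Sum>(C - {b})"
    using True bit_vec_add_eq_0_iff by metis
  then have "b \<in> aff (C - {b})"
    unfolding aff_def using card by (intro CollectI exI [of _ "C - {b}"]) auto
  then have "aff (insert b (C - {b})) = aff (C - {b})"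
    by (rule aff_insert_absorb)
  then have "cap_dim C = cap_dim (C - {b})"
    using b by (simp add: cap_dim_def insert_absorb)
  ultimately show ?thesis
    using True by simp
qed

lemma card_cap_in_4_flat_le:
  assumes "r_flat 4 F" "D \<subseteq> F" "cap D"
  shows "card D \<le> 6"
proof (rule ccontr)
  assume "\<not> card D \<le> 6"
  then obtain E where E: "E \<subseteq> D" "card E = 7"
    using obtain_subset_with_card_n [of 7 D] by auto
  \<comment> \<open>Deleting \<open>x\<close> leaves a 6-cap inside \<open>F\<close>, of dimension
    at most 4 and hence with sum zero. So \<open>x\<close> alone accounts for the sum of
    \<open>E\<close>.\<close>
  have sum_E: "\<Sum>E = x" if "x \<in> E" for x
  proof -
    have "k_cap 6 (E - {x})"
      using E that assms(3) cap_subset [of D "E - {x}"] by (auto simp: k_cap_def)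
    moreover from this have "E - {x} \<noteq> {}"
      by (metis card.empty k_cap_def zero_neq_numeral)
    then have "cap_dim (E - {x}) \<le> 4"
      using E assms by (intro cap_dim_le_of_subset_flat) auto
    ultimately have "\<Sum>(E - {x}) = 0"
      by (auto simp: six_cap_dim split: if_splits)
    then show ?thesis
      using that by (simp add: sum.remove [of E x])
  qed
  obtain x where "x \<in> E"
    using E by fastforce
  moreover have "E \<subseteq> {\<Sum>E}"
    using sum_E by blast
  then have "card E \<le> 1"
    using card_mono [of "{\<Sum>E}" E] by simp
  ultimately show False
    using E by simp
qed

lemma six_cap_multiplicity:
  assumes "k_cap 6 C" "\<Sum>C = 0" "p \<in> exc C"
  shows "multiplicity_exc C p = 2"
proof -
  have card_C: "card C = 6"
    using assms by (simp add: k_cap_def)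
  obtain a b c where abc: "a \<in> C" "b \<in> C" "c \<in> C" "distinct [a, b, c]" "p = a + b + c"
    using assms(3) by (auto simp: exc_def)
  define T where "T = {a, b, c}"
  have T: "T \<subseteq> C" "card T = 3" "\<Sum>T = p"
    using abc by (auto simp: T_def ac_simps)
  have "\<Sum>C = \<Sum>(C - T) + \<Sum>T"
    using T(1) by (intro sum.subset_diff) auto
  \<comment> \<open>The total sum is zero, so complementary triples have equal sums; this supplies
    the second representation of \<open>p\<close>.\<close>
  then have compl: "\<Sum>(C - T) = p"
    using T(3) assms(2) bit_vec_add_eq_0_iff by metis
  have card_compl: "card (C - T) = 3"
    using T card_C by (simp add: card_Diff_subset)
  \<comment> \<open>The symmetric difference of two triples with sum \<open>p\<close> is even with
    sum zero, hence empty or all of \<open>C\<close>.\<close>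
  have "U = T \<or> U = C - T" if U: "U \<subseteq> C" "card U = 3" "\<Sum>U = p" for U
  proof -
    have "sym_diff U T \<subseteq> C"
      using U T by blast
    moreover have "even (card (sym_diff U T))"
      using U T by (subst even_card_sym_diff) auto
    moreover have "\<Sum>(sym_diff U T) = 0"
      unfolding sum_sym_diff using U T by simp
    ultimately have "sym_diff U T = {} \<or> sym_diff U T = C"
      using assms(1) six_cap_even_zero_sum_subset by blast
    then show ?thesis
      using U(1) T(1) by blast
  qed
  then have "{U. U \<subseteq> C \<and> card U = 3 \<and> \<Sum>U = p} = {T, C - T}"
    using T compl card_compl by auto
  moreover have "T \<noteq> C - T"
    using T(2) by (metis Diff_disjoint Int_absorb card.empty zero_neq_numeral)
  ultimately show ?thesis
    by (simp add: multiplicity_exc_def)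
qed

theorem theorem5p16:
  fixes C :: "(bit ^ 'n) set"
  assumes "k_cap 6 C"
  shows "cap_dim C \<in> {4, 5} \<and>
    (cap_dim C = 5 \<longrightarrow> affinely_independent C) \<and>
    (cap_dim C = 4 \<longrightarrow>
      complete_cap_in (aff C) C \<and>
      maximal_cap 4 C \<and>
      (\<forall>p \<in> exc C. multiplicity_exc C p = 2))"
proof (cases "\<Sum>C = 0")
  case False
  then show ?thesis
    using assms six_cap_affinely_independent by (simp add: six_cap_dim)
next
  case True
  have C: "cap C" "card C = 6" "C \<noteq> {}"
    using assms by (auto simp: k_cap_def)
  have dim: "cap_dim C = 4"
    using assms True by (simp add: six_cap_dim)
  have "\<not> cap (insert p C)" if p: "p \<in> aff C - C" for p
  proof
    \<comment> \<open>This would be a cap of size 7 in a 4-flat, so completeness follows from the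
      size bound, as does maximality below.\<close>
    assume "cap (insert p C)"
    moreover have "r_flat 4 (aff C)"
      using C(3) r_flat_aff dim by metis
    moreover have "insert p C \<subseteq> aff C"
      using p subset_aff by blast
    ultimately have "card (insert p C) \<le> 6"
      using card_cap_in_4_flat_le by blast
    then show False
      using p C(2) by simp
  qed
  then have complete: "complete_cap_in (aff C) C"
    using C(1) subset_aff by (auto simp: complete_cap_in_def)
  moreover have "maximal_cap 4 C"
    using C complete dim card_cap_in_4_flat_le by (auto simp: maximal_cap_def)
  ultimately show ?thesis
    using assms True dim six_cap_multiplicity by auto
qed

end
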